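(* Let $(\xi_j)_{j\ge 0}$ be a sequence of independent and identically distributed random variables taking values in $\mathbb{Z}$ with $\max_{x\in\mathbb{Z}}\mathbb{P}(\xi_0=x)\le\frac12$, and for $n\in\mathbb{N}$ let $P(z)=P_n(z)=\sum_{j=0}^n\xi_j z^j$. Then there exists $\varepsilon>0$ such that for all $n\in\mathbb{N}$ large enough and for each $a\in\{-2,2\}$, $$\max_{m\in\mathbb{Z}}\mathbb{P}\big(P_n(a)=m\big)\le 2^{-n(\frac12+\varepsilon)}.$$
   Context: The law of $\xi_0$ is fixed; $\varepsilon$ may depend on it but not on $n$. *)

theory Defs
  imports "HOL-Probability.Probability"
begin

definition random_poly :: "(nat \<Rightarrow> 'a \<Rightarrow> int) \<Rightarrow> nat \<Rightarrow> int \<Rightarrow> 'a \<Rightarrow> int" where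
  "random_poly \<xi> n z \<omega> = (\<Sum>j\<le>n. \<xi> j \<omega> * z ^ j)"

(* The atoms of a law on the integers are summable, so for measurable X the supremum below
   is attained and is a maximum. Max cannot be used: the set of values {P(X = x) | x} may be
   infinite. *)
definition max_prob :: "'a measure \<Rightarrow> ('a \<Rightarrow> int) \<Rightarrow> real" where
  "max_prob M X = (SUP x. \<P>(\<omega> in M. X \<omega> = x))"

definition iid_int :: "'a measure \<Rightarrow> (nat \<Rightarrow> 'a \<Rightarrow> int) \<Rightarrow> bool" where
  "iid_int M \<xi> \<longleftrightarrow>
     prob_space.indep_vars M (\<lambda>_. count_space UNIV) \<xi> UNIV \<and>
     (\<forall>j. distr M (count_space UNIV) (\<xi> j) = distr M (count_space UNIV) (\<xi> 0))"

end

(* An integer law without an atom above 1/2 is a mixture of uniform laws on two-point sets {x, y}.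
   Given these sets, xi_j * a^j takes two values whose difference has 2-adic valuation
   j + w_j, where w_j is the valuation of x_j - y_j, and the conditional probability of any value
   of P_n(a) is at most 2^(-S) with S the number of distinct valuations; reducing them modulo
   L = n + 1 only decreases S. By independence, E 2^(-S) is the average over all subsets A of Z/L of
   prod_j P(j + w_j mod L in A). As x <= exp(x - 1) and the probabilities
   P(j + w_j mod L = i) sum to 1 over j, this product is at most exp(|A| - L), and averaging gives
   ((1 + 1/e) / 2)^L <= (7/10)^L. Finally 7/10 < 2^(-1/2). *)
theory Submission
  imports Defs
begin

section \<open>Decomposition into uniform laws on two-point sets\<close>

text \<open>Disjoint supports force \<open>x \<noteq> y\<close>, so each point of the drawn pair
  gets weight 1/2 and the mixture averages the two marginals.\<close>

lemma bind_pair_pmf_of_set: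
  assumes "set_pmf p \<inter> set_pmf q = {}"
  shows "pmf (bind_pmf (pair_pmf p q) (\<lambda>(x, y). pmf_of_set {x, y})) z = (pmf p z + pmf q z) / 2"
proof -
  let ?N = "measure_pmf (pair_pmf p q)"
  have "pmf (bind_pmf (pair_pmf p q) (\<lambda>(x, y). pmf_of_set {x, y})) z
      = (\<integral>w. pmf (case w of (x, y) \<Rightarrow> pmf_of_set {x, y}) z \<partial>?N)"
    by (rule pmf_bind)
  also have "\<dots> = (\<integral>w. (indicator (fst -` {z}) w + indicator (snd -` {z}) w) / 2 \<partial>?N)"
    using assms
    by (intro integral_cong_AE)
       (auto simp: AE_measure_pmf_iff indicator_def pmf_of_set card_insert_if)
  also have "\<dots> = (measure ?N (fst -` {z}) + measure ?N (snd -` {z})) / 2"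
    by (simp add: integrable_real_indicator measure_pmf.emeasure_eq_measure)
  also have "\<dots> = (pmf (map_pmf fst (pair_pmf p q)) z + pmf (map_pmf snd (pair_pmf p q)) z) / 2"
    by (simp only: pmf_map)
  finally show ?thesis
    by (simp add: map_fst_pair_pmf map_snd_pair_pmf)
qed

text \<open>Points drawn from two different parts are automatically distinct. The bound 1/2 makes
  \<open>1 - 2 * m s\<close> nonnegative, and these three numbers sum to 1, so they can serve as
  probabilities for the part that is left out.\<close>

lemma two_point_mixture_of_partition:
  fixes \<mu> :: "'a pmf" and G :: "'a \<Rightarrow> nat"
  assumes G: "\<And>x. G x < 3"
    and half: "\<And>i. measure \<mu> (G -` {i}) \<le> 1 / 2"
  obtains C where "\<And>x y. (x, y) \<in> set_pmf C \<Longrightarrow> x \<noteq> y"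
    "\<mu> = bind_pmf C (\<lambda>(x, y). pmf_of_set {x, y})"
proof -
  define m where "m i = measure \<mu> (G -` {i})" for i
  define \<nu> where "\<nu> i = cond_pmf \<mu> (G -` {i})" for i
  have three: "{..<3} = {0, 1, 2 :: nat}"
    by auto
  have "measure \<mu> (\<Union>i\<in>{..<3}. G -` {i}) = (\<Sum>i<3. m i)"
    unfolding m_def
    by (rule measure_pmf.finite_measure_finite_Union) (auto simp: disjoint_family_on_def)
  moreover have "(\<Union>i\<in>{..<3}. G -` {i}) = UNIV"
    using G by blast
  ultimately have m_sum: "m 0 + m 1 + m 2 = 1"
    by (simp add: three)
  have m_half: "m i \<le> 1 / 2" for i
    using half by (simp add: m_def)
  \<comment> \<open>\<open>cond_pmf\<close> is specified only for a set that meets the support,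
    hence the guard \<open>m i > 0\<close>.\<close>
  have \<nu>: "m i > 0 \<Longrightarrow> set_pmf (\<nu> i) = set_pmf \<mu> \<inter> G -` {i}"
    "m i > 0 \<Longrightarrow> pmf (\<nu> i) z = (if G z = i then pmf \<mu> z / m i else 0)" for i z
  proof -
    assume "m i > 0"
    then have "set_pmf \<mu> \<inter> G -` {i} \<noteq> {}"
      unfolding m_def by (metis measure_Int_set_pmf measure_empty inf_commute less_irrefl)
    then show "set_pmf (\<nu> i) = set_pmf \<mu> \<inter> G -` {i}"
      "pmf (\<nu> i) z = (if G z = i then pmf \<mu> z / m i else 0)"
      by (auto simp: \<nu>_def pmf_cond m_def)
  qed
  \<comment> \<open>The pair avoids part s with probability 1 - 2 m_s: the only weights for which the two coordinates
    together give part i the mass 2 m_i.\<close>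
  define xs where "xs = [(0 :: nat, 1 - 2 * m 0), (1, 1 - 2 * m 1), (2, 1 - 2 * m 2)]"
  define S where "S = pmf_of_list xs"
  have wf: "pmf_of_list_wf xs"
    using m_half[of 0] m_half[of 1] m_half[of 2] m_sum by (intro pmf_of_list_wfI) (auto simp: xs_def)
  have S: "pmf S s = (if s < 3 then 1 - 2 * m s else 0)" for s
    unfolding S_def pmf_pmf_of_list[OF wf] by (auto simp: xs_def numeral_3_eq_3 numeral_2_eq_2 less_Suc_eq)
  have set_S: "s < 3 \<and> m s < 1 / 2" if "s \<in> set_pmf S" for s
    using that pmf_positive[OF that] by (auto simp: S split: if_splits)
  \<comment> \<open>The cyclic successor on the three labels: \<open>nx s\<close> and
    \<open>nx (nx s)\<close> are the two parts other than \<open>s\<close>.\<close>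
  define nx where "nx = (\<lambda>s :: nat. (s + 1) mod 3)"
  have nx: "nx s \<noteq> nx (nx s)" for s
    unfolding nx_def by presburger
  have nx_simps [simp]: "nx 0 = 1" "nx 1 = 2" "nx (Suc 0) = 2" "nx 2 = 0"
    by (auto simp: nx_def)
  \<comment> \<open>If \<open>m s < 1 / 2\<close>, the other two masses sum to more than 1/2 while
    neither exceeds 1/2, so both are positive.\<close>
  have pos: "m (nx s) > 0 \<and> m (nx (nx s)) > 0" if "s \<in> set_pmf S" for s
  proof -
    from set_S[OF that] have "s = 0 \<or> s = 1 \<or> s = 2" "m s < 1 / 2"
      by auto
    then show ?thesis
      using m_sum m_half[of 0] m_half[of 1] m_half[of 2] by auto
  qed
  define C where "C = bind_pmf S (\<lambda>s. pair_pmf (\<nu> (nx s)) (\<nu> (nx (nx s))))"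
  have ne: "x \<noteq> y" if xy: "(x, y) \<in> set_pmf C" for x y
  proof -
    obtain s where s: "s \<in> set_pmf S" "x \<in> set_pmf (\<nu> (nx s))" "y \<in> set_pmf (\<nu> (nx (nx s)))"
      using xy by (auto simp: C_def)
    then have "G x = nx s" "G y = nx (nx s)"
      using pos[OF s(1)] by (auto simp: \<nu>(1))
    then show ?thesis
      using nx[of s] by auto
  qed
  have "pmf (bind_pmf C (\<lambda>(x, y). pmf_of_set {x, y})) z = pmf \<mu> z" for z
  proof -
    have "pmf (bind_pmf C (\<lambda>(x, y). pmf_of_set {x, y})) z
        = (\<integral>s. pmf (bind_pmf (pair_pmf (\<nu> (nx s)) (\<nu> (nx (nx s)))) (\<lambda>(x, y). pmf_of_set {x, y})) z \<partial>S)"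
      by (simp add: C_def bind_assoc_pmf pmf_bind)
    also have "\<dots> = (\<integral>s. (pmf (\<nu> (nx s)) z + pmf (\<nu> (nx (nx s))) z) / 2 \<partial>S)"
    proof (intro integral_cong_AE)
      show "AE s in S. pmf (bind_pmf (pair_pmf (\<nu> (nx s)) (\<nu> (nx (nx s)))) (\<lambda>(x, y). pmf_of_set {x, y})) z
          = (pmf (\<nu> (nx s)) z + pmf (\<nu> (nx (nx s))) z) / 2"
        unfolding AE_measure_pmf_iff
      proof
        fix s assume "s \<in> set_pmf S"
        then have "set_pmf (\<nu> (nx s)) \<inter> set_pmf (\<nu> (nx (nx s))) = {}"
          using pos[of s] nx[of s] by (auto simp: \<nu>)
        then show "pmf (bind_pmf (pair_pmf (\<nu> (nx s)) (\<nu> (nx (nx s)))) (\<lambda>(x, y). pmf_of_set {x, y})) z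
          = (pmf (\<nu> (nx s)) z + pmf (\<nu> (nx (nx s))) z) / 2"
          by (rule bind_pair_pmf_of_set)
      qed
    qed auto
    also have "\<dots> = (\<Sum>s<3. pmf S s * ((pmf (\<nu> (nx s)) z + pmf (\<nu> (nx (nx s))) z) / 2))"
      by (subst integral_measure_pmf[where A = "{..<3}"]) (use set_S in auto)
    \<comment> \<open>Where \<open>s\<close> is outside the support of \<open>S\<close> the weight
      vanishes, so the formula for the conditional laws may be inserted for all three
      \<open>s\<close>.\<close>
    also have "\<dots> = (\<Sum>s<3. (1 - 2 * m s) * ((if G z = nx s then pmf \<mu> z / m (nx s) else 0)
        + (if G z = nx (nx s) then pmf \<mu> z / m (nx (nx s)) else 0)) / 2)"
    proof (intro sum.cong refl)
      fix s :: nat assume s: "s \<in> {..<3}"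
      show "pmf S s * ((pmf (\<nu> (nx s)) z + pmf (\<nu> (nx (nx s))) z) / 2)
        = (1 - 2 * m s) * ((if G z = nx s then pmf \<mu> z / m (nx s) else 0)
        + (if G z = nx (nx s) then pmf \<mu> z / m (nx (nx s)) else 0)) / 2"
      proof (cases "s \<in> set_pmf S")
        case True
        then show ?thesis
          using pos[of s] s by (simp add: \<nu>(2) S)
      next
        case False
        then have "pmf S s = 0" "1 - 2 * m s = 0"
          using s S[of s] by (auto simp: set_pmf_iff)
        then show ?thesis by simp
      qed
    qed
    also have "\<dots> = pmf \<mu> z"
    proof (cases "m (G z) = 0")
      case True
      then have "z \<notin> set_pmf \<mu>"
        unfolding m_def measure_pmf_zero_iff by auto
      then have "pmf \<mu> z = 0"
        by (simp add: set_pmf_iff)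
      then show ?thesis by (simp cong: if_cong)
    next
      case False
      \<comment> \<open>Here \<open>M\<close> is the mass of the part containing \<open>z\<close>,
        \<open>q\<close> is the mass of \<open>z\<close>, and \<open>a\<close>, \<open>b\<close> are
        the masses of the other two parts. The part of \<open>z\<close> takes part when one of those
        two is left out.\<close>
      have avg: "(1 - 2 * a) * (q / M) / 2 + (1 - 2 * b) * (q / M) / 2 = q"
        if "a + b + M = 1" "M \<noteq> 0" for a b M q :: real
      proof -
        have "(1 - 2 * a) * r / 2 + (1 - 2 * b) * r / 2 = (1 - a - b) * r" for r
          by (simp add: field_simps)
        from this[of "q / M"]
        have "(1 - 2 * a) * (q / M) / 2 + (1 - 2 * b) * (q / M) / 2 = (1 - a - b) * (q / M)" .
        also have "1 - a - b = M"
          using that by simp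
        finally show ?thesis
          using that by simp
      qed
      consider "G z = 0" | "G z = 1" | "G z = 2"
        using G[of z] by linarith
      then show ?thesis
        using False m_sum avg[of "m 1" "m 2" "m 0" "pmf \<mu> z"]
          avg[of "m 0" "m 2" "m 1" "pmf \<mu> z"] avg[of "m 0" "m 1" "m 2" "pmf \<mu> z"]
        by cases (simp_all add: three)
    qed
    finally show ?thesis .
  qed
  then have "\<mu> = bind_pmf C (\<lambda>(x, y). pmf_of_set {x, y})"
    by (intro pmf_eqI) simp
  with ne show thesis
    by (rule that)
qed

text \<open>Cutting an enumeration at a median \<open>k\<close> yields the three parts before, at
  and after \<open>k\<close>. Minimality of \<open>k\<close> bounds the first mass, the bound on
  atoms the second, and \<open>F k \<ge> 1 / 2\<close> the third.\<close>

lemma two_point_mixture: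
  fixes \<mu> :: "'a :: countable pmf"
  assumes half: "\<And>x. pmf \<mu> x \<le> 1 / 2"
  obtains C where "\<And>x y. (x, y) \<in> set_pmf C \<Longrightarrow> x \<noteq> y"
    "\<mu> = bind_pmf C (\<lambda>(x, y). pmf_of_set {x, y})"
proof -
  define F where "F k = measure \<mu> {x. to_nat x \<le> k}" for k
  have "F \<longlonglongrightarrow> measure \<mu> (\<Union>k. {x. to_nat x \<le> k})"
    unfolding F_def by (intro measure_pmf.finite_Lim_measure_incseq) (auto simp: incseq_def)
  also have "(\<Union>k. {x :: 'a. to_nat x \<le> k}) = UNIV"
    by auto
  finally have "F \<longlonglongrightarrow> 1"
    by simp
  then have "\<forall>\<^sub>F k in sequentially. F k > 1 / 2"
    by (rule order_tendstoD) simp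
  then obtain k\<^sub>0 where "F k\<^sub>0 \<ge> 1 / 2"
    by (metis eventually_sequentially le_refl less_imp_le)
  define k where "k = (LEAST k. F k \<ge> 1 / 2)"
  have k: "F k \<ge> 1 / 2"
    unfolding k_def by (rule LeastI) fact
  define G :: "'a \<Rightarrow> nat" where "G x = (if to_nat x < k then 0 else if to_nat x = k then 1 else 2)" for x
  have low: "measure \<mu> {x. to_nat x < k} \<le> 1 / 2"
  proof (cases k)
    case (Suc j)
    then have "\<not> F j \<ge> 1 / 2"
      using not_less_Least[of j "\<lambda>k. F k \<ge> 1 / 2"] by (simp add: k_def)
    then show ?thesis
      by (simp add: F_def Suc less_Suc_eq_le)
  qed simp
  have mid: "measure \<mu> {x. to_nat x = k} \<le> 1 / 2"
  proof (cases "\<exists>x :: 'a. to_nat x = k")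
    case True
    then obtain x :: 'a where "to_nat x = k"
      by blast
    then have "{x :: 'a. to_nat x = k} = {x}"
      by (auto simp: inj_eq)
    then show ?thesis
      using half[of x] by (simp add: measure_pmf_single)
  qed simp
  have high: "measure \<mu> {x. k < to_nat x} \<le> 1 / 2"
  proof -
    have "measure \<mu> {x. k < to_nat x} = 1 - F k"
      unfolding F_def using measure_pmf.prob_compl[of "{x. to_nat x \<le> k}" \<mu>]
      by (simp add: Compl_eq_Diff_UNIV[symmetric] Collect_neg_eq[symmetric] not_le)
    then show ?thesis
      using k by simp
  qed
  have "measure \<mu> (G -` {i}) \<le> 1 / 2" for i
  proof -
    consider "i = 0" | "i = 1" | "i = 2" | "i > 2"
      by linarith
    then show ?thesis
    proof cases
      case 1
      have "G -` {0} = {x. to_nat x < k}"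
        by (simp add: G_def vimage_def) (metis less_irrefl)
      with low 1 show ?thesis by simp
    next
      case 2
      have "G -` {1} = {x. to_nat x = k}"
        by (simp add: G_def vimage_def set_eq_iff)
      with mid 2 show ?thesis by simp
    next
      case 3
      have "G -` {2} = {x. k < to_nat x}"
        by (simp add: G_def vimage_def set_eq_iff not_less_iff_gr_or_eq)
      with high 3 show ?thesis by simp
    next
      case 4
      then have "G -` {i} = {}"
        by (simp add: G_def vimage_def)
      then show ?thesis by simp
    qed
  qed
  moreover have "G x < 3" for x
    by (simp add: G_def)
  ultimately show thesis
    using two_point_mixture_of_partition[of G \<mu>] that by blast
qed

section \<open>2-adic valuations and counting of choices\<close>

lemma multiplicity_uminus_int: "multiplicity p (- x) = multiplicity p (x :: int)"
  using multiplicity_times_unit_right[of "- 1 :: int" p x] by simp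

text \<open>A unique term has the least valuation; the next power of 2 divides every other term but
  not this one, so nothing can cancel it.\<close>

lemma sum_distinct_multiplicity_nonzero:
  fixes d :: "'i \<Rightarrow> int"
  assumes "finite D" "D \<noteq> {}" "\<And>j. j \<in> D \<Longrightarrow> d j \<noteq> 0"
    and inj: "inj_on (\<lambda>j. multiplicity 2 (d j)) D"
  shows "(\<Sum>j\<in>D. d j) \<noteq> 0"
proof
  assume sum0: "(\<Sum>j\<in>D. d j) = 0"
  obtain i where i: "i \<in> D" and least: "\<And>j. j \<in> D \<Longrightarrow> multiplicity 2 (d i) \<le> multiplicity 2 (d j)"
    using ex_is_arg_min_if_finite[OF assms(1,2), of "\<lambda>j. multiplicity 2 (d j)"]
    by (auto simp: is_arg_min_linorder)
  let ?k = "Suc (multiplicity 2 (d i))"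
  have "2 ^ ?k dvd (\<Sum>j\<in>D - {i}. d j)"
  proof (rule dvd_sum)
    fix j assume j: "j \<in> D - {i}"
    then have "multiplicity 2 (d i) \<noteq> multiplicity 2 (d j)"
      using inj i by (auto simp: inj_on_def)
    with least[of j] j show "2 ^ ?k dvd d j"
      by (intro multiplicity_dvd') auto
  qed
  moreover have "d i = - (\<Sum>j\<in>D - {i}. d j)"
    using sum0 i assms(1) by (simp add: sum.remove)
  ultimately have "2 ^ ?k dvd d i"
    by simp
  then show False
    using assms(3)[OF i] by (subst (asm) power_dvd_iff_le_multiplicity) auto
qed

text \<open>Choices at indices whose differences have pairwise distinct 2-adic positions are determined
  by the value of the sum and the remaining choices.\<close>
lemma card_two_point_choices_le:
  fixes x y :: "nat \<Rightarrow> int" and a :: int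
  assumes a: "a \<in> {- 2, 2}" and ne: "\<And>j. j < L \<Longrightarrow> x j \<noteq> y j"
  defines "K \<equiv> (\<lambda>j. (j + multiplicity 2 (x j - y j)) mod L) ` {..<L}"
  shows "card {f \<in> PiE_dflt {..<L} 0 (\<lambda>j. {x j, y j}). (\<Sum>j<L. f j * a ^ j) = m} \<le> 2 ^ (L - card K)"
proof -
  define \<kappa> where "\<kappa> j = j + multiplicity 2 (x j - y j)" for j
  \<comment> \<open>One representative index is chosen for each residue in \<open>K\<close>.
    Distinct residues force distinct valuations \<open>\<kappa> j\<close>.\<close>
  obtain J where J: "J \<subseteq> {..<L}" "inj_on (\<lambda>j. \<kappa> j mod L) J" "K = (\<lambda>j. \<kappa> j mod L) ` J"
    using subset_image_inj[of K "\<lambda>j. \<kappa> j mod L" "{..<L}"] unfolding K_def \<kappa>_def by auto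
  have finJ: "finite J"
    using J(1) finite_subset by blast
  have \<kappa>_inj: "inj_on \<kappa> J"
    using J(2) by (auto simp: inj_on_def)
  let ?F = "{f \<in> PiE_dflt {..<L} 0 (\<lambda>j. {x j, y j}). (\<Sum>j<L. f j * a ^ j) = m}"
  let ?P = "PiE_dflt ({..<L} - J) 0 (\<lambda>j. {x j, y j})"
  \<comment> \<open>Forgets the choices on \<open>J\<close>; the value 0 matches the default of
    \<open>PiE_dflt\<close>, so the image lies in \<open>?P\<close>.\<close>
  let ?r = "\<lambda>(f :: nat \<Rightarrow> int) j. if j \<in> J then 0 else f j"
  have mult: "multiplicity 2 (a ^ j) = j" for j
  proof -
    have "multiplicity 2 a = 1"
      using a by (auto simp: multiplicity_uminus_int)
    then show ?thesis
      using a by (subst prime_elem_multiplicity_power_distrib) auto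
  qed
  \<comment> \<open>Two solutions that agree off \<open>J\<close> differ by terms
    \<open>\<plusminus>(x j - y j) * a ^ j\<close> with distinct valuations, whose sum would have to
    be 0.\<close>
  have "inj_on ?r ?F"
  proof (rule inj_onI, rule ccontr)
    fix f g assume f: "f \<in> ?F" and g: "g \<in> ?F" and r: "?r f = ?r g" and "f \<noteq> g"
    define D where "D = {j. f j \<noteq> g j}"
    have DJ: "D \<subseteq> J"
    proof
      fix j assume "j \<in> D"
      then show "j \<in> J"
        using fun_cong[OF r, of j] by (auto simp: D_def split: if_splits)
    qed
    have D0: "D \<noteq> {}"
      using \<open>f \<noteq> g\<close> by (auto simp: D_def)
    have diff: "f j - g j = x j - y j \<or> f j - g j = - (x j - y j)" if "j \<in> D" for j
    proof -
      have "j < L" using that DJ J(1) by auto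
      then have "f j \<in> {x j, y j}" "g j \<in> {x j, y j}"
        using f g by (auto simp: PiE_dflt_def)
      then show ?thesis using that by (auto simp: D_def)
    qed
    have "multiplicity 2 ((f j - g j) * a ^ j) = \<kappa> j" if "j \<in> D" for j
    proof -
      have "multiplicity 2 (f j - g j) = multiplicity 2 (x j - y j)"
        using diff[OF that] by (metis multiplicity_uminus_int)
      moreover have "f j - g j \<noteq> 0" "a ^ j \<noteq> 0"
        using that a by (auto simp: D_def)
      ultimately show ?thesis
        by (simp add: prime_elem_multiplicity_mult_distrib mult \<kappa>_def)
    qed
    then have "inj_on (\<lambda>j. multiplicity 2 ((f j - g j) * a ^ j)) D"
      using inj_on_subset[OF \<kappa>_inj DJ] by (simp add: inj_on_def)
    then have "(\<Sum>j\<in>D. (f j - g j) * a ^ j) \<noteq> 0"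
      using D0 finite_subset[OF DJ finJ] a
      by (intro sum_distinct_multiplicity_nonzero) (auto simp: D_def)
    also have "(\<Sum>j\<in>D. (f j - g j) * a ^ j) = (\<Sum>j<L. (f j - g j) * a ^ j)"
      using DJ J(1) by (intro sum.mono_neutral_left) (auto simp: D_def)
    also have "\<dots> = 0"
      using f g by (simp add: left_diff_distrib sum_subtractf)
    finally show False by simp
  qed
  moreover have "?r ` ?F \<subseteq> ?P"
    by (auto simp: PiE_dflt_def)
  moreover have "finite ?P"
    by auto
  ultimately have "card ?F \<le> card ?P"
    by (rule card_inj_on_le)
  also have "\<dots> \<le> (\<Prod>j\<in>{..<L} - J. 2)"
  proof (subst card_PiE_dflt)
    show "(\<Prod>j\<in>{..<L} - J. card {x j, y j}) \<le> (\<Prod>j\<in>{..<L} - J. 2)"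
      by (intro prod_mono) (simp add: card_insert_if)
  qed auto
  also have "\<dots> = 2 ^ (L - card J)"
    using J(1) finJ by (simp add: card_Diff_subset)
  also have "card J = card K"
    using J(2,3) by (simp add: card_image)
  finally show ?thesis .
qed

section \<open>Averaging over subsets of the residues\<close>

text \<open>Used to write \<open>2 ^ (L - card K)\<close> as a sum of indicators of
  \<open>K \<subseteq> A\<close>. Each such event is a conjunction of conditions on single
  coordinates, so independence applies to it.\<close>

lemma card_supersets:
  assumes "finite U" "K \<subseteq> U"
  shows "card {A \<in> Pow U. K \<subseteq> A} = 2 ^ (card U - card K)"
proof -
  have "bij_betw (\<lambda>A. A - K) {A \<in> Pow U. K \<subseteq> A} (Pow (U - K))"
    by (rule bij_betw_byWitness[where f' = "\<lambda>B. B \<union> K"]) (use assms in auto)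
  then have "card {A \<in> Pow U. K \<subseteq> A} = card (Pow (U - K))"
    by (rule bij_betw_same_card)
  then show ?thesis
    using assms by (simp add: card_Pow card_Diff_subset finite_subset)
qed

text \<open>Adding a fixed \<open>w z\<close> permutes the residues modulo \<open>L\<close>, so for
  every \<open>z\<close> exactly one \<open>j\<close> reaches \<open>i\<close>. Integrating over the
  law \<open>C\<close>, common to all \<open>j\<close>, gives total mass 1.\<close>

lemma sum_prob_cyclic_shift:
  fixes C :: "'a pmf" and w :: "'a \<Rightarrow> nat"
  assumes "i < L"
  shows "(\<Sum>j<L. measure C {z. (j + w z) mod L = i}) = 1"
proof -
  have one: "(\<Sum>j<L. indicator {z. (j + w z) mod L = i} z) = (1 :: real)" for z
  proof -
    \<comment> \<open>The solution of the congruence in \<open>{..<L}\<close>, computed in the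
      integers because subtraction of naturals truncates.\<close>
    define j\<^sub>0 where "j\<^sub>0 = nat ((int i - int (w z)) mod int L)"
    have "j < L \<and> (j + w z) mod L = i \<longleftrightarrow> j = j\<^sub>0" for j
    proof -
      have "j < L \<and> (j + w z) mod L = i
          \<longleftrightarrow> j < L \<and> (int j + int (w z)) mod int L = int i mod int L"
        using assms by (auto simp flip: of_nat_add of_nat_mod)
      also have "\<dots> \<longleftrightarrow> j < L \<and> int j mod int L = (int i - int (w z)) mod int L"
        by (simp add: mod_eq_dvd_iff algebra_simps)
      also have "\<dots> \<longleftrightarrow> j = j\<^sub>0"
        using assms by (auto simp: j\<^sub>0_def nat_less_iff) 
      finally show ?thesis .
    qed
    then have "{j. j < L \<and> (j + w z) mod L = i} = {j\<^sub>0}"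
      by auto
    then have "card {j \<in> {..<L}. (j + w z) mod L = i} = 1"
      by simp
    then show ?thesis
      by (simp add: indicator_def sum.If_cases Int_def)
  qed
  have "(\<Sum>j<L. measure C {z. (j + w z) mod L = i})
      = (\<integral>z. (\<Sum>j<L. indicator {z. (j + w z) mod L = i} z) \<partial>C)"
    by (subst Bochner_Integration.integral_sum)
       (simp_all add: integrable_real_indicator measure_pmf.emeasure_eq_measure)
  also have "\<dots> = 1"
    unfolding one by simp
  finally show ?thesis .
qed

text \<open>The constant 2/5 yields the base (1 + 2/5) / 2 = 7/10, whose square 49/100 is below
  1/2.\<close>

lemma exp_minus_one_le: "exp (- 1 :: real) \<le> 2 / 5"
proof -
  have "5 / 2 \<le> exp (1 :: real)"
    using exp_lower_Taylor_quadratic[of 1] by simp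
  then show ?thesis
    by (simp add: exp_minus field_simps)
qed

text \<open>The quantity on the left is the probability that independent fair coins come up heads at all
  of the positions (j + w z_j) mod L.\<close>
lemma expected_coverage_le:
  fixes C :: "'a pmf" and w :: "'a \<Rightarrow> nat"
  shows "(\<Sum>A\<in>Pow {..<L}. \<Prod>j<L. measure C {z. (j + w z) mod L \<in> A}) / 2 ^ L \<le> (7 / 10) ^ L"
proof -
  have "(\<Prod>j<L. measure C {z. (j + w z) mod L \<in> A}) \<le> exp (- 1) ^ (L - card A)"
    if A: "A \<subseteq> {..<L}" for A
  proof -
    have finA: "finite A" using A finite_subset by blast
    have split: "measure C {z. (j + w z) mod L \<in> A} = (\<Sum>i\<in>A. measure C {z. (j + w z) mod L = i})" for j
    proof -
      have "{z. (j + w z) mod L \<in> A} = (\<Union>i\<in>A. {z. (j + w z) mod L = i})"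
        by auto
      then show ?thesis
        using finA by (simp, intro measure_pmf.finite_measure_finite_Union) (auto simp: disjoint_family_on_def)
    qed
    have "(\<Prod>j<L. measure C {z. (j + w z) mod L \<in> A})
        \<le> (\<Prod>j<L. exp (measure C {z. (j + w z) mod L \<in> A} - 1))"
    proof (rule prod_mono, intro conjI measure_nonneg)
      fix j
      show "measure C {z. (j + w z) mod L \<in> A} \<le> exp (measure C {z. (j + w z) mod L \<in> A} - 1)"
        using exp_ge_add_one_self[of "measure C {z. (j + w z) mod L \<in> A} - 1"] by simp
    qed
    also have "\<dots> = exp ((\<Sum>j<L. \<Sum>i\<in>A. measure C {z. (j + w z) mod L = i}) - L)"
      by (simp add: split flip: exp_sum) (simp add: sum_subtractf)
    also have "(\<Sum>j<L. \<Sum>i\<in>A. measure C {z. (j + w z) mod L = i})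
        = (\<Sum>i\<in>A. \<Sum>j<L. measure C {z. (j + w z) mod L = i})"
      by (rule sum.swap)
    also have "\<dots> = (\<Sum>i\<in>A. 1)"
      using A by (intro sum.cong sum_prob_cyclic_shift) auto
    also have "exp ((\<Sum>i\<in>A. 1) - real L) = exp (- 1) ^ (L - card A)"
    proof -
      have "card A \<le> L"
        using card_mono[OF _ A] by simp
      then show ?thesis
        by (simp flip: exp_of_nat_mult add: of_nat_diff)
    qed
    finally show ?thesis .
  qed
  then have "(\<Sum>A\<in>Pow {..<L}. \<Prod>j<L. measure C {z. (j + w z) mod L \<in> A})
      \<le> (\<Sum>A\<in>Pow {..<L}. exp (- 1) ^ (L - card A))"
    by (intro sum_mono) auto
  \<comment> \<open>This is the expansion of a product of sums: each \<open>i\<close> contributes 1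
    if it lies in \<open>A\<close> and \<open>exp (- 1)\<close> otherwise.\<close>
  also have "\<dots> = (\<Sum>A\<in>Pow {..<L}. (\<Prod>i\<in>A. 1) * (\<Prod>i\<in>{..<L} - A. exp (- 1)))"
    by (intro sum.cong refl) (auto simp: card_Diff_subset finite_subset)
  also have "\<dots> = (\<Prod>i<L. 1 + exp (- 1))"
    by (rule prod_add [symmetric]) simp
  also have "\<dots> \<le> (\<Prod>i<L. 7 / 5)"
    using exp_minus_one_le by (intro prod_mono) (auto simp: add_nonneg_nonneg)
  finally have "(\<Sum>A\<in>Pow {..<L}. \<Prod>j<L. measure C {z. (j + w z) mod L \<in> A}) / 2 ^ L \<le> (7 / 5) ^ L / 2 ^ L"
    by (intro divide_right_mono) simp_all
  also have "\<dots> = (7 / 10 :: real) ^ L"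
    by (simp flip: power_divide)
  finally show ?thesis .
qed

section \<open>The bound for the product law\<close>

text \<open>Sampling in two stages, first the pairs and then a fair choice in each, bounds the
  probability by the mean of \<open>2 ^ (L - card K) / 2 ^ L\<close>, which becomes the average over
  subsets in \<open>expected_coverage_le\<close>.\<close>

lemma measure_Pi_pmf_sum_powers_le:
  fixes \<mu> :: "int pmf" and a :: int
  assumes half: "\<And>x. pmf \<mu> x \<le> 1 / 2" and a: "a \<in> {- 2, 2}"
  shows "measure (Pi_pmf {..<L} 0 (\<lambda>_. \<mu>)) {f. (\<Sum>j<L. f j * a ^ j) = m} \<le> (7 / 10) ^ L"
proof -
  obtain C where C: "\<And>x y. (x, y) \<in> set_pmf C \<Longrightarrow> x \<noteq> y"
    "\<mu> = bind_pmf C (\<lambda>(x, y). pmf_of_set {x, y})"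
    by (rule two_point_mixture[OF half]) (rule that)
  define w where "w z = multiplicity 2 (fst z - snd z :: int)" for z
  define s where "s f = (\<Sum>j<L. f j * a ^ j)" for f :: "nat \<Rightarrow> int"
  \<comment> \<open>\<open>P\<close> draws the pairs, \<open>Q p\<close> picks a point from each of
    them, and \<open>B A\<close> is the event that all positions lie in \<open>A\<close>.\<close>
  define P where "P = Pi_pmf {..<L} (0, 0) (\<lambda>_. C)"
  define Q where "Q p = Pi_pmf {..<L} 0 (\<lambda>j. pmf_of_set {fst (p j), snd (p j)})"
    for p :: "nat \<Rightarrow> int \<times> int"
  define B where "B A = Pi {..<L} (\<lambda>j. {z. (j + w z) mod L \<in> A})" for A
  have "Pi_pmf {..<L} 0 (\<lambda>_. \<mu>) = bind_pmf P Q"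
    unfolding C(2) P_def Q_def
    by (subst Pi_pmf_bind[where d' = "(0, 0)"]) (simp_all add: case_prod_unfold)
  then have "measure (Pi_pmf {..<L} 0 (\<lambda>_. \<mu>)) {f. s f = m} = pmf (map_pmf s (bind_pmf P Q)) m"
    by (simp add: pmf_map vimage_def)
  also have "\<dots> = (\<integral>p. measure (Q p) (s -` {m}) \<partial>P)"
    by (simp add: map_bind_pmf pmf_bind pmf_map)
  also have "\<dots> \<le> (\<integral>p. (\<Sum>A\<in>Pow {..<L}. indicator (B A) p) / 2 ^ L \<partial>P)"
  proof (rule integral_mono_AE)
    show "integrable P (\<lambda>p. measure (Q p) (s -` {m}))"
      by (intro measure_pmf.integrable_const_bound[where B = 1]) auto
    show "integrable P (\<lambda>p. (\<Sum>A\<in>Pow {..<L}. indicator (B A) p) / 2 ^ L :: real)"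
      by (auto simp: integrable_real_indicator measure_pmf.emeasure_eq_measure)
    show "AE p in P. measure (Q p) (s -` {m}) \<le> (\<Sum>A\<in>Pow {..<L}. indicator (B A) p) / 2 ^ L"
      unfolding AE_measure_pmf_iff
    proof
      \<comment> \<open>Given the pairs, the choice is uniform on \<open>2 ^ L\<close> functions, so
        the conditional probability is a normalized count of solutions.\<close>
      fix p assume "p \<in> set_pmf P"
      then have ne: "fst (p j) \<noteq> snd (p j)" if "j < L" for j
        using that C(1)[of "fst (p j)" "snd (p j)"] by (auto simp: P_def set_Pi_pmf PiE_dflt_def)
      let ?D = "PiE_dflt {..<L} 0 (\<lambda>j. {fst (p j), snd (p j)})"
      define K where "K = (\<lambda>j. (j + w (p j)) mod L) ` {..<L}"
      have K: "K \<subseteq> {..<L}"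
        by (auto simp: K_def)
      have card_D: "card ?D = 2 ^ L"
        using ne by (subst card_PiE_dflt) (auto simp: card_insert_if numeral_2_eq_2)
      have "Q p = pmf_of_set ?D"
        unfolding Q_def by (rule Pi_pmf_of_set) auto
      moreover have "finite ?D"
        by auto
      ultimately have "measure_pmf.prob (Q p) (s -` {m}) = real (card {f \<in> ?D. s f = m}) / 2 ^ L"
        using card_D by (simp add: measure_pmf_of_set Int_def vimage_def)
      also have "\<dots> \<le> 2 ^ (L - card K) / 2 ^ L"
      proof (rule divide_right_mono)
        show "real (card {f \<in> ?D. s f = m}) \<le> 2 ^ (L - card K)"
        proof -
          have "card {f \<in> ?D. s f = m} \<le> 2 ^ (L - card K)"
            unfolding K_def w_def s_def by (rule card_two_point_choices_le[OF a ne])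
          then have "real (card {f \<in> ?D. s f = m}) \<le> real (2 ^ (L - card K))"
            by (simp only: of_nat_le_iff)
          then show ?thesis by simp
        qed
      qed simp
      \<comment> \<open>Membership of \<open>p\<close> in \<open>B A\<close> means
        \<open>K \<subseteq> A\<close>, so the indicators count the supersets of
        \<open>K\<close>.\<close>
      also have "2 ^ (L - card K) = (\<Sum>A\<in>Pow {..<L}. indicator (B A) p :: real)"
      proof -
        have "indicator (B A) p = (if K \<subseteq> A then 1 else 0 :: real)" for A
          by (auto simp: B_def K_def indicator_def Pi_def)
        then have "(\<Sum>A\<in>Pow {..<L}. indicator (B A) p :: real) = card {A \<in> Pow {..<L}. K \<subseteq> A}"
          by (simp add: sum.If_cases Int_def)
        also have "\<dots> = 2 ^ (L - card K)"
          using card_supersets[of "{..<L}" K] K by simp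
        finally show ?thesis ..
      qed
      finally show "measure (Q p) (s -` {m}) \<le> (\<Sum>A\<in>Pow {..<L}. indicator (B A) p) / 2 ^ L" .
    qed
  qed
  also have "\<dots> = (\<Sum>A\<in>Pow {..<L}. measure P (B A)) / 2 ^ L"
    by (simp add: Bochner_Integration.integral_sum integrable_real_indicator
        measure_pmf.emeasure_eq_measure)
  also have "\<dots> = (\<Sum>A\<in>Pow {..<L}. \<Prod>j<L. measure C {z. (j + w z) mod L \<in> A}) / 2 ^ L"
    unfolding P_def B_def by (simp add: measure_Pi_pmf_Pi)
  also have "\<dots> \<le> (7 / 10) ^ L"
    by (rule expected_coverage_le)
  finally show ?thesis
    unfolding s_def .
qed

section \<open>From random variables to a product of discrete laws\<close>

text \<open>The event splits into countably many disjoint cylinders, one per vector of coefficients,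
  and independence gives each cylinder its mass under \<open>Pi_pmf\<close>.\<close>

lemma (in prob_space) iid_int_conv_Pi_pmf:
  assumes "iid_int M \<xi>"
  obtains \<mu> where "\<And>x. pmf \<mu> x = \<P>(\<omega> in M. \<xi> 0 \<omega> = x)"
    "\<And>n a m. \<P>(\<omega> in M. random_poly \<xi> n a \<omega> = m)
       \<le> measure (Pi_pmf {..<Suc n} 0 (\<lambda>_. \<mu>)) {f. (\<Sum>j<Suc n. f j * a ^ j) = m}"
proof -
  have indep: "indep_vars (\<lambda>_. count_space UNIV) \<xi> UNIV"
    and distr: "\<And>j. distr M (count_space UNIV) (\<xi> j) = distr M (count_space UNIV) (\<xi> 0)"
    using assms by (auto simp: iid_int_def)
  have meas [measurable]: "\<xi> j \<in> measurable M (count_space UNIV)" for j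
    using indep by (auto simp: indep_vars_def)
  define \<mu> where "\<mu> = embed_pmf (\<lambda>x. \<P>(\<omega> in M. \<xi> 0 \<omega> = x))"
  have \<mu>: "pmf \<mu> x = \<P>(\<omega> in M. \<xi> 0 \<omega> = x)" for x
    unfolding \<mu>_def
  proof (rule pmf_embed_pmf)
    have "(\<integral>\<^sup>+x. \<P>(\<omega> in M. \<xi> 0 \<omega> = x) \<partial>count_space UNIV)
        = (\<integral>\<^sup>+x. emeasure M {\<omega> \<in> space M. \<xi> 0 \<omega> = x} \<partial>count_space UNIV)"
      by (simp add: emeasure_eq_measure)
    also have "\<dots> = emeasure M (\<Union>x. {\<omega> \<in> space M. \<xi> 0 \<omega> = x})"
      by (rule emeasure_UN_countable [symmetric]) (auto simp: disjoint_family_on_def)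
    also have "(\<Union>x. {\<omega> \<in> space M. \<xi> 0 \<omega> = x}) = space M"
      by auto
    finally show "(\<integral>\<^sup>+x. \<P>(\<omega> in M. \<xi> 0 \<omega> = x) \<partial>count_space UNIV) = 1"
      by (simp add: emeasure_space_1)
  qed simp
  have marginal: "prob (\<xi> j -` {x} \<inter> space M) = pmf \<mu> x" for j x
  proof -
    have "prob (\<xi> j -` {x} \<inter> space M) = measure (distr M (count_space UNIV) (\<xi> j)) {x}"
      by (simp add: measure_distr)
    also have "\<dots> = measure (distr M (count_space UNIV) (\<xi> 0)) {x}"
      using distr[of j] by (rule arg_cong)
    also have "\<dots> = pmf \<mu> x"
      unfolding \<mu> by (subst measure_distr) (simp_all add: vimage_def Int_def conj_commute)
    finally show ?thesis .
  qed
  have "\<P>(\<omega> in M. random_poly \<xi> n a \<omega> = m)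
       \<le> measure (Pi_pmf {..<Suc n} 0 (\<lambda>_. \<mu>)) {f. (\<Sum>j<Suc n. f j * a ^ j) = m}" for n a m
  proof -
    let ?U = "{..<Suc n}"
    let ?p = "Pi_pmf ?U 0 (\<lambda>_. \<mu>)"
    \<comment> \<open>Coefficient vectors are encoded as functions with value 0 beyond
      \<open>n\<close>, the default of \<open>?p\<close>. This makes \<open>D\<close> countable and
      forces distinct vectors to differ at an index in \<open>?U\<close>.\<close>
    define D where "D = PiE_dflt ?U (0 :: int) (\<lambda>_. UNIV)"
    define I where "I = {f \<in> D. (\<Sum>j<Suc n. f j * a ^ j) = m}"
    define E where "E f = (\<Inter>j\<in>?U. \<xi> j -` {f j} \<inter> space M)" for f
    have "countable D"
      unfolding D_def dflt_image_PiE [symmetric] by (intro countable_image countable_PiE) auto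
    then have "countable I"
      by (rule countable_subset[rotated]) (auto simp: I_def)
    have E_sets: "E f \<in> sets M" for f
      unfolding E_def by (intro sets.finite_INT) auto
    have prob_E: "prob (E f) = pmf ?p f" if "f \<in> D" for f
    proof -
      have "prob (E f) = (\<Prod>j\<in>?U. prob (\<xi> j -` {f j} \<inter> space M))"
        unfolding E_def by (rule indep_varsD[OF indep]) auto
      also have "\<dots> = pmf ?p f"
        using that by (subst pmf_Pi') (auto simp: marginal D_def PiE_dflt_def)
      finally show ?thesis .
    qed
    have "{\<omega> \<in> space M. random_poly \<xi> n a \<omega> = m} = (\<Union>f\<in>I. E f)"
    proof (intro equalityI subsetI)
      fix \<omega> assume \<omega>: "\<omega> \<in> {\<omega> \<in> space M. random_poly \<xi> n a \<omega> = m}"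
      let ?f = "\<lambda>j. if j < Suc n then \<xi> j \<omega> else 0"
      have "(\<Sum>j<Suc n. ?f j * a ^ j) = (\<Sum>j\<le>n. \<xi> j \<omega> * a ^ j)"
        unfolding lessThan_Suc_atMost by (rule sum.cong) auto
      then have "?f \<in> I"
        using \<omega> unfolding I_def D_def PiE_dflt_def random_poly_def by (simp del: sum.lessThan_Suc)
      moreover have "\<omega> \<in> E ?f"
        using \<omega> unfolding E_def by simp
      ultimately show "\<omega> \<in> (\<Union>f\<in>I. E f)"
        by blast
    next
      fix \<omega> assume "\<omega> \<in> (\<Union>f\<in>I. E f)"
      then obtain f where f: "f \<in> I" "\<omega> \<in> E f"
        by blast
      have "f j = \<xi> j \<omega>" if "j \<le> n" for j
        using INT_D[OF f(2)[unfolded E_def], of j] that by simp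
      then have "(\<Sum>j<Suc n. f j * a ^ j) = random_poly \<xi> n a \<omega>"
        unfolding lessThan_Suc_atMost random_poly_def by (intro sum.cong) simp_all
      then have "random_poly \<xi> n a \<omega> = m"
        using f(1) unfolding I_def by simp
      moreover have "\<omega> \<in> \<xi> 0 -` {f 0} \<inter> space M"
        using f(2) unfolding E_def by (rule INT_D) simp
      ultimately show "\<omega> \<in> {\<omega> \<in> space M. random_poly \<xi> n a \<omega> = m}"
        by simp
    qed
    moreover have "disjoint_family_on E I"
      unfolding disjoint_family_on_def
    proof (intro ballI impI)
      fix f g assume "f \<in> I" "g \<in> I" "f \<noteq> g"
      then obtain j where j: "j \<in> ?U" "f j \<noteq> g j"
        by (auto simp: I_def D_def PiE_dflt_def fun_eq_iff) metis
      have "E h \<subseteq> \<xi> j -` {h j}" for h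
        unfolding E_def using INT_lower[OF j(1), of "\<lambda>j. \<xi> j -` {h j} \<inter> space M"] by blast
      then have "E f \<inter> E g \<subseteq> \<xi> j -` {f j} \<inter> \<xi> j -` {g j}"
        by (intro Int_mono)
      also have "\<dots> = {}"
        using j(2) by auto
      finally show "E f \<inter> E g = {}"
        by simp
    qed
    ultimately have "emeasure M {\<omega> \<in> space M. random_poly \<xi> n a \<omega> = m}
        = (\<integral>\<^sup>+f. emeasure M (E f) \<partial>count_space I)"
      using E_sets \<open>countable I\<close>
      by (simp add: emeasure_UN_countable)
    also have "\<dots> = (\<integral>\<^sup>+f. pmf ?p f \<partial>count_space I)"
      by (intro nn_integral_cong) (auto simp: emeasure_eq_measure prob_E I_def)
    also have "\<dots> = emeasure ?p I"
      by (rule nn_integral_pmf)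
    also have "\<dots> \<le> emeasure ?p {f. (\<Sum>j<Suc n. f j * a ^ j) = m}"
      by (rule emeasure_mono) (auto simp: I_def)
    finally show ?thesis
      by (simp add: emeasure_eq_measure measure_pmf.emeasure_eq_measure)
  qed
  with \<mu> show thesis
    by (rule that)
qed

section \<open>Conversion to the required exponent\<close>

theorem theorem1p2:
  fixes M :: "'a measure" and \<xi> :: "nat \<Rightarrow> 'a \<Rightarrow> int"
  assumes "prob_space M"
    and "iid_int M \<xi>"
    and "max_prob M (\<xi> 0) \<le> 1 / 2"
  shows "\<exists>\<epsilon>::real. \<epsilon> > 0 \<and>
    (\<forall>\<^sub>F n in sequentially. \<forall>a \<in> {- 2, 2}.
       max_prob M (random_poly \<xi> n a) \<le> 2 powr (- real n * (1 / 2 + \<epsilon>)))"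
proof -
  interpret prob_space M by fact
  obtain \<mu> where \<mu>: "\<And>x. pmf \<mu> x = \<P>(\<omega> in M. \<xi> 0 \<omega> = x)"
    and poly: "\<And>n a m. \<P>(\<omega> in M. random_poly \<xi> n a \<omega> = m)
       \<le> measure (Pi_pmf {..<Suc n} 0 (\<lambda>_. \<mu>)) {f. (\<Sum>j<Suc n. f j * a ^ j) = m}"
    by (rule iid_int_conv_Pi_pmf[OF assms(2)]) (rule that)
  have half: "pmf \<mu> x \<le> 1 / 2" for x
  proof -
    have "pmf \<mu> x \<le> max_prob M (\<xi> 0)"
      unfolding \<mu> max_prob_def by (rule cSUP_upper) (auto intro!: bdd_aboveI2[where M = 1])
    with assms(3) show ?thesis by simp
  qed
  have bound: "max_prob M (random_poly \<xi> n a) \<le> (7 / 10) ^ n" if "a \<in> {- 2, 2}" for n a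
    unfolding max_prob_def
  proof (rule cSUP_least)
    fix m
    have "\<P>(\<omega> in M. random_poly \<xi> n a \<omega> = m) \<le> (7 / 10) ^ Suc n"
      \<comment> \<open>There are \<open>Suc n\<close> coefficients, so \<open>L = n + 1\<close>;
        one factor 7/10 is then dropped to match the exponent \<open>n\<close>.\<close>
      using poly[of n a m] measure_Pi_pmf_sum_powers_le[OF half that, of "Suc n" m] by linarith
    also have "\<dots> \<le> (7 / 10) ^ n"
      by simp
    finally show "\<P>(\<omega> in M. random_poly \<xi> n a \<omega> = m) \<le> (7 / 10) ^ n" .
  qed simp
  \<comment> \<open>Solves \<open>2 powr (- (1 / 2 + \<epsilon>)) = 7 / 10\<close>. It is positive
    because 49/100 < 1/2, and it is the same for every law of the coefficients.\<close>
  define \<epsilon> :: real where "\<epsilon> = - log 2 (7 / 10) - 1 / 2"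
  have "log 2 ((7 / 10) ^ 2) < log 2 (1 / 2 :: real)"
    by (subst log_less_cancel_iff) (simp_all add: power2_eq_square)
  then have "\<epsilon> > 0"
    by (simp add: \<epsilon>_def log_nat_power log_divide)
  moreover have "(7 / 10) ^ n = 2 powr (- real n * (1 / 2 + \<epsilon>))" for n
  proof -
    have "2 powr (- real n * (1 / 2 + \<epsilon>)) = (2 powr log 2 (7 / 10)) powr real n"
      unfolding powr_powr \<epsilon>_def by (simp add: mult.commute)
    then show ?thesis
      by (simp add: powr_realpow)
  qed
  ultimately show ?thesis
    using bound by (intro exI[of _ \<epsilon>] conjI always_eventually allI ballI) simp_all
qed

end
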